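(* Let $d\ge3$ be an integer, let $G$ be an arbitrary connected $d$-regular graph, let $o\in V(G)$ be an arbitrary vertex, and let $\emptyset\neq S\subseteq V(G)$. Let $a_t(S)$ be the number of non-backtracking walks of length $t$ in $G$ from $o$ into $S$, and $b_t(S)$ the number of arbitrary walks of length $t$ in $G$ from $o$ into $S$. Then: (1) With $\alpha(S)=\limsup_{t\to\infty}a_t(S)^{1/t}$ and $\beta(S)=\limsup_{t\to\infty}b_t(S)^{1/t}$, one has $\beta(S)=g_d(\alpha(S))$. (2) The same formula holds for ordinary limits: (a) If $\tilde\alpha(S)=\lim_{t\to\infty}a_t(S)^{1/t}$ exists, and there are both a walk of even length and a walk of odd length from $o$ into $S$, then $\tilde\beta(S)=\lim_{t\to\infty}b_t(S)^{1/t}$ exists and $\tilde\beta(S)=g_d(\tilde\alpha(S))$. (b) If $\tilde\alpha^{\mathrm{even}}(S)=\lim_{t\to\infty}a_{2t}(S)^{1/(2t)}$ exists and there is a walk of even length from $o$ into $S$, then $\tilde\beta^{\mathrm{even}}(S)=\lim_{t\to\infty}b_{2t}(S)^{1/(2t)}$ exists and $\tilde\beta^{\mathrm{even}}(S)=g_d(\tilde\alpha^{\mathrm{even}}(S))$. (c) If $\tilde\alpha^{\mathrm{odd}}(S)=\lim_{t\to\infty}a_{2t+1}(S)^{1/(2t+1)}$ exists and there is a walk of odd length from $o$ into $S$, then $\tilde\beta^{\mathrm{odd}}(S)=\lim_{t\to\infty}b_{2t+1}(S)^{1/(2t+1)}$ exists and $\tilde\beta^{\mathrm{odd}}(S)=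g_d(\tilde\alpha^{\mathrm{odd}}(S))$.
   Context: The graph $G$ may be finite or infinite. A walk is non-backtracking if it never traverses an edge and then immediately traverses the same edge in the reverse direction. A walk "from $o$ into $S$" is a walk starting at $o$ and ending at a vertex of $S$; walks of length $0$ are allowed. The map $g_d\colon\mathbb{R}_{\ge0}\to[2\sqrt{d-1},\infty)$ is defined by $g_d(\alpha)=2\sqrt{d-1}$ if $\alpha\le\sqrt{d-1}$, and $g_d(\alpha)=\alpha+\frac{d-1}{\alpha}$ if $\alpha\ge\sqrt{d-1}$. *)

theory Defs
  imports
    "HOL-Library.Extended_Real"
    "Graph_Theory.Bidirected_Digraph"
    "Graph_Theory.Arc_Walk"
    "Graph_Theory.Digraph_Component"
begin

text \<open>
  An undirected graph is a bidirected digraph: every edge is represented by its two orientations,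
  which are exchanged by the fixed-point-free involution \<open>arev\<close>. Parallel edges and loops are
  permitted (a loop has two orientations, so it contributes 2 to the degree), and the graph may be
  infinite. A simple graph is the case where the arcs are the ordered pairs of adjacent vertices
  and \<open>arev\<close> swaps the components of such a pair.
\<close>

text \<open>
  \<open>card\<close> is 0 on infinite sets, so for \<open>d > 0\<close> the condition implies local finiteness.
\<close>

definition regular_graph :: "('v, 'e) pre_digraph \<Rightarrow> nat \<Rightarrow> bool" where
  "regular_graph G d \<longleftrightarrow> (\<forall>v \<in> verts G. out_degree G v = d)"

definition walks_into :: "('v, 'e) pre_digraph \<Rightarrow> 'v \<Rightarrow> 'v set \<Rightarrow> nat \<Rightarrow> 'e awalk set" where
  "walks_into G x S t = {p. length p = t \<and> (\<exists>v \<in> S. pre_digraph.awalk G x p v)}"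

definition non_backtracking :: "('e \<Rightarrow> 'e) \<Rightarrow> 'e awalk \<Rightarrow> bool" where
  "non_backtracking arev p \<longleftrightarrow> successively (\<lambda>e f. f \<noteq> arev e) p"

definition num_walks :: "('v, 'e) pre_digraph \<Rightarrow> 'v \<Rightarrow> 'v set \<Rightarrow> nat \<Rightarrow> nat" where
  "num_walks G x S t = card (walks_into G x S t)"

definition num_nb_walks ::
    "('v, 'e) pre_digraph \<Rightarrow> ('e \<Rightarrow> 'e) \<Rightarrow> 'v \<Rightarrow> 'v set \<Rightarrow> nat \<Rightarrow> nat" where
  "num_nb_walks G arev x S t = card {p \<in> walks_into G x S t. non_backtracking arev p}"

text \<open>Only the values at nonnegative arguments are meaningful.\<close>

definition g :: "nat \<Rightarrow> real \<Rightarrow> real" where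
  "g d \<alpha> = (if \<alpha> \<le> sqrt (real d - 1) then 2 * sqrt (real d - 1)
            else \<alpha> + (real d - 1) / \<alpha>)"

end

theory Submission
  imports Defs
begin

text \<open>
  Let \<open>N k m\<close> count the walks from \<open>x\<close> into \<open>S\<close> of length \<open>k + m\<close> whose first \<open>k\<close> arcs form a
  non-backtracking walk, so that \<open>a k = N k 0\<close> and \<open>b m = N 0 m\<close>. The first unrestricted arc
  either prolongs the non-backtracking part or cancels its last arc, which with \<open>q = d - 1\<close> gives
  \<open>N k (m + 1) = N (k + 1) m + q * N (k - 1) m\<close> for \<open>k \<ge> 2\<close>, and similar equations for
  \<open>k \<le> 1\<close>. Everything else follows from this recurrence. Its exact solutions
  \<open>r ^ k * (r + q / r) ^ m\<close> can be modified near \<open>k = 0\<close> to supersolutions, which bound \<open>b\<close>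
  from above, and to subsolutions, which bound it from below if \<open>r > sqrt q\<close>. The lower bound
  \<open>2 * sqrt q\<close> comes from a subsolution \<open>sqrt q ^ k * sin (k * pi / L)\<close> supported on
  \<open>{0..L}\<close>. For the limit superior, where \<open>a\<close> may be large only rarely, a bound on \<open>b\<close> is
  turned into one on \<open>a\<close> by summing the recurrence over \<open>m\<close> with geometric weights.
\<close>

section \<open>Counting partially non-backtracking walks\<close>

lemma non_backtracking_snoc:
  "non_backtracking arev (p @ [e]) \<longleftrightarrow> non_backtracking arev p \<and> (p = [] \<or> e \<noteq> arev (last p))"
  by (auto simp: non_backtracking_def successively_append_iff)

lemma non_backtracking_short [simp]: "non_backtracking arev []" "non_backtracking arev [e]"
  by (simp_all add: non_backtracking_def)

context wf_digraph
begin

text \<open>Splitting off the first arc leaves \<open>d\<close> choices at every step. The bound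
  \<open>d ^ n\<close> later makes the limit superior of the roots finite.\<close>

lemma finite_card_walks_from:
  assumes reg: "regular_graph G d" and d: "0 < d"
  shows "finite (walks_into G x (verts G) n) \<and> card (walks_into G x (verts G) n) \<le> d ^ n"
proof (induction n arbitrary: x)
  case 0
  have "walks_into G x (verts G) 0 \<subseteq> {[]}" by (auto simp: walks_into_def)
  from card_mono[OF _ this] finite_subset[OF this] show ?case by simp
next
  case (Suc n)
  show ?case
  proof (cases "x \<in> verts G")
    case False
    hence "walks_into G x (verts G) (Suc n) = {}"
      by (auto simp: walks_into_def dest: awalk_hd_in_verts)
    thus ?thesis by simp
  next
    case True
    have deg: "card (out_arcs G x) = d"
      using reg True by (simp add: regular_graph_def out_degree_def)
    hence fin: "finite (out_arcs G x)" using d by (metis card.infinite less_irrefl)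
    define U where "U = (\<Union>e\<in>out_arcs G x. (#) e ` walks_into G (head G e) (verts G) n)"
    have sub: "walks_into G x (verts G) (Suc n) \<subseteq> U"
    proof
      fix p assume "p \<in> walks_into G x (verts G) (Suc n)"
      then obtain e p' v where "p = e # p'" "length p' = n" "v \<in> verts G" "awalk x (e # p') v"
        by (auto simp: walks_into_def length_Suc_conv)
      thus "p \<in> U"
        by (auto simp: U_def awalk_Cons_iff walks_into_def intro!: bexI[of _ e])
    qed
    have "card U \<le> (\<Sum>e\<in>out_arcs G x. card ((#) e ` walks_into G (head G e) (verts G) n))"
      unfolding U_def by (rule card_UN_le[OF fin])
    also have "\<dots> \<le> (\<Sum>e\<in>out_arcs G x. d ^ n)"
      using Suc.IH by (intro sum_mono) (simp add: card_image)
    also have "\<dots> = d ^ Suc n" using deg by simp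
    finally have "card U \<le> d ^ Suc n" .
    moreover have "finite U" unfolding U_def using fin Suc.IH by auto
    ultimately show ?thesis using sub by (meson card_mono finite_subset order_trans)
  qed
qed

end

section \<open>Partially non-backtracking walks and bijections between them\<close>

context bidirected_digraph
begin

text \<open>The junction is unconstrained: the first arc of \<open>p'\<close> may reverse the last
  arc of \<open>p\<close>.\<close>

definition mixed_walks :: "'a \<Rightarrow> 'a set \<Rightarrow> nat \<Rightarrow> nat \<Rightarrow> ('b awalk \<times> 'b awalk) set" where
  "mixed_walks x S k m = {(p, p'). length p = k \<and> length p' = m \<and> non_backtracking arev p
     \<and> (\<exists>v\<in>S. awalk x (p @ p') v)}"

lemma finite_mixed_walks:
  assumes "regular_graph G d" "0 < d"
  shows "finite (mixed_walks x S k m)"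
proof (rule finite_subset)
  show "mixed_walks x S k m \<subseteq> (\<lambda>p. (take k p, drop k p)) ` walks_into G x (verts G) (k + m)"
  proof clarify
    fix p p' assume "(p, p') \<in> mixed_walks x S k m"
    thus "(p, p') \<in> (\<lambda>p. (take k p, drop k p)) ` walks_into G x (verts G) (k + m)"
      by (intro image_eqI[of _ _ "p @ p'"])
        (auto simp: mixed_walks_def walks_into_def intro: awalk_last_in_verts)
  qed
qed (use finite_card_walks_from[OF assms] in auto)

lemma card_mixed_walks_0_left: "card (mixed_walks x S 0 m) = num_walks G x S m"
  unfolding num_walks_def
  by (rule bij_betw_same_card[of snd], rule bij_betw_byWitness[of _ "Pair []"])
    (auto simp: mixed_walks_def walks_into_def simp del: awalk_append_iff)

lemma card_mixed_walks_0_right: "card (mixed_walks x S k 0) = num_nb_walks G arev x S k"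
  unfolding num_nb_walks_def
  by (rule bij_betw_same_card[of fst], rule bij_betw_byWitness[of _ "\<lambda>p. (p, [])"])
    (auto simp: mixed_walks_def walks_into_def simp del: awalk_append_iff)

definition nb_extensions :: "'a \<Rightarrow> 'b awalk \<Rightarrow> 'b set" where
  "nb_extensions x p = {e \<in> out_arcs G (awlast x p). p = [] \<or> e \<noteq> arev (last p)}"

text \<open>For a nonempty walk only the reverse of the last arc is excluded, and it does leave the
  end vertex. This is the source of the coefficients \<open>q + 1\<close> and
  \<open>q\<close>.\<close>

lemma card_nb_extensions:
  assumes reg: "regular_graph G d" and d: "0 < d" and p: "awalk x p v"
  shows "finite (nb_extensions x p)"
    and "card (nb_extensions x p) = (if p = [] then d else d - 1)"
proof -
  have v: "awlast x p = v" "v \<in> verts G" using p by auto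
  have deg: "card (out_arcs G v) = d"
    using reg v by (simp add: regular_graph_def out_degree_def)
  hence fin: "finite (out_arcs G v)" using d by (metis card.infinite less_irrefl)
  thus "finite (nb_extensions x p)"
    unfolding nb_extensions_def v(1) by (rule rev_finite_subset) auto
  show "card (nb_extensions x p) = (if p = [] then d else d - 1)"
  proof (cases p rule: rev_cases)
    case Nil
    thus ?thesis using deg v by (simp add: nb_extensions_def out_arcs_def)
  next
    case (snoc p0 e)
    hence "e \<in> arcs G" "head G e = v" using p by (auto simp: awalk_Cons_iff awalk_Nil_iff)
    hence "arev e \<in> out_arcs G v" by simp
    moreover have "nb_extensions x p = out_arcs G v - {arev e}"
      unfolding nb_extensions_def v using snoc by auto
    ultimately show ?thesis using deg fin snoc by simp
  qed
qed

text \<open>The first free arc moves to the end of the non-backtracking part; the side condition is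
  exactly what \<open>non_backtracking_snoc\<close> asks for.\<close>

lemma card_mixed_walks_forward:
  "card {w \<in> mixed_walks x S k (Suc m). fst w = [] \<or> hd (snd w) \<noteq> arev (last (fst w))}
    = card (mixed_walks x S (Suc k) m)" (is "card ?A = card ?B")
proof (rule bij_betw_same_card[of "\<lambda>(p, p'). (p @ [hd p'], tl p')"],
    rule bij_betw_byWitness[of _ "\<lambda>(p, p'). (butlast p, last p # p')"])
  show "(\<lambda>(p, p'). (p @ [hd p'], tl p')) ` ?A \<subseteq> ?B"
    by (auto simp: mixed_walks_def length_Suc_conv[of _ m] non_backtracking_snoc
        simp del: awalk_append_iff)
  show "(\<lambda>(p, p'). (butlast p, last p # p')) ` ?B \<subseteq> ?A"
  proof (rule image_subsetI)
    fix w assume a: "w \<in> ?B"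
    obtain p p' where w: "w = (p, p')" by (cases w)
    with a obtain p0 e where "p = p0 @ [e]"
      by (cases p rule: rev_cases) (auto simp: mixed_walks_def)
    with a w show "(case w of (p, p') \<Rightarrow> (butlast p, last p # p')) \<in> ?A"
      by (auto simp: mixed_walks_def non_backtracking_snoc simp del: awalk_append_iff)
  qed
qed (auto simp: mixed_walks_def length_Suc_conv neq_Nil_conv)

text \<open>Deleting the cancelling arcs \<open>e\<close> and \<open>arev e\<close> leaves a shorter
  pair, and \<open>e\<close> can be any of the \<open>nb_extensions\<close> of its first part, hence
  the factor.\<close>

lemma card_mixed_walks_back:
  assumes "regular_graph G d" "0 < d"
  shows "card {w \<in> mixed_walks x S (Suc k) (Suc m). \<not> (fst w = [] \<or> hd (snd w) \<noteq> arev (last (fst w)))}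
    = (if k = 0 then d else d - 1) * card (mixed_walks x S k m)" (is "card ?A = _")
proof -
  define B where "B = (SIGMA w:mixed_walks x S k m. nb_extensions x (fst w))"
  have "card ?A = card B"
  proof (rule bij_betw_same_card[of "\<lambda>(p, p'). ((butlast p, tl p'), last p)"],
      rule bij_betw_byWitness[of _ "\<lambda>((p, p'), e). (p @ [e], arev e # p')"])
    show "(\<lambda>(p, p'). ((butlast p, tl p'), last p)) ` ?A \<subseteq> B"
    proof (rule image_subsetI)
      fix w assume a: "w \<in> ?A"
      obtain p p' where w: "w = (p, p')" by (cases w)
      with a obtain p0 e q where "p = p0 @ [e]" "p' = arev e # q"
        by (cases p rule: rev_cases; cases p') (auto simp: mixed_walks_def)
      with a w show "(case w of (p, p') \<Rightarrow> ((butlast p, tl p'), last p)) \<in> B"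
        by (auto simp: B_def mixed_walks_def nb_extensions_def non_backtracking_snoc awalk_simps)
    qed
    show "(\<lambda>((p, p'), e). (p @ [e], arev e # p')) ` B \<subseteq> ?A"
      by (auto simp: B_def mixed_walks_def nb_extensions_def non_backtracking_snoc awalk_simps)
  qed (auto simp: B_def mixed_walks_def length_Suc_conv neq_Nil_conv)
  also have "card B = (\<Sum>w\<in>mixed_walks x S k m. card (nb_extensions x (fst w)))"
    unfolding B_def
  proof (rule card_SigmaI)
    show "\<forall>w\<in>mixed_walks x S k m. finite (nb_extensions x (fst w))"
      using card_nb_extensions(1)[OF assms] by (auto simp: mixed_walks_def)
  qed (rule finite_mixed_walks[OF assms])
  also have "\<dots> = (\<Sum>w\<in>mixed_walks x S k m. if k = 0 then d else d - 1)"
    using card_nb_extensions(2)[OF assms] by (intro sum.cong refl) (auto simp: mixed_walks_def)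
  finally show ?thesis by simp
qed

lemma card_mixed_walks_Suc:
  assumes "regular_graph G d" "0 < d"
  shows "card (mixed_walks x S k (Suc m)) = card (mixed_walks x S (Suc k) m)
    + (case k of 0 \<Rightarrow> 0 | Suc j \<Rightarrow> (if j = 0 then d else d - 1) * card (mixed_walks x S j m))"
proof -
  let ?P = "\<lambda>w. fst w = [] \<or> hd (snd w) \<noteq> arev (last (fst w))"
  let ?M = "mixed_walks x S k (Suc m)"
  have "card ?M = card {w \<in> ?M. ?P w} + card {w \<in> ?M. \<not> ?P w}"
    using finite_mixed_walks[OF assms, of x S k "Suc m"]
    by (subst card_Un_disjoint[symmetric]) (auto intro: arg_cong[of _ _ card])
  also have "card {w \<in> ?M. ?P w} = card (mixed_walks x S (Suc k) m)"
    by (rule card_mixed_walks_forward)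
  also have "card {w \<in> ?M. \<not> ?P w}
      = (case k of 0 \<Rightarrow> 0 | Suc j \<Rightarrow> (if j = 0 then d else d - 1) * card (mixed_walks x S j m))"
  proof (cases k)
    case 0
    hence "{w \<in> ?M. \<not> ?P w} = {}" by (auto simp: mixed_walks_def)
    with 0 show ?thesis by (simp del: Collect_empty_eq)
  next
    case (Suc j)
    thus ?thesis using card_mixed_walks_back[OF assms, of x S j m] by simp
  qed
  finally show ?thesis .
qed

lemma symmetric_bidirected: "symmetric G"
  unfolding symmetric_conv
  by (metis arev_in_arcs head_arev tail_arev)

text \<open>Connectedness speaks of the symmetric closure, which has the same reachability as the
  bidirected graph itself.\<close>

lemma connected_walk_exists:
  assumes "Digraph_Component.connected G" "x \<in> verts G" "S \<noteq> {}" "S \<subseteq> verts G"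
  shows "\<exists>t. walks_into G x S t \<noteq> {}"
proof -
  from assms obtain v where v: "v \<in> S" "v \<in> verts G" by auto
  have "x \<rightarrow>\<^sup>*\<^bsub>mk_symmetric G\<^esub> v"
    using assms v by (simp add: connected_def strongly_connected_def)
  hence "x \<rightarrow>\<^sup>*\<^bsub>G\<^esub> v" by (simp only: reachable_mk_symmetric_eq[OF symmetric_bidirected])
  then obtain p where "awalk x p v" by (auto simp: reachable_awalk)
  hence "p \<in> walks_into G x S (length p)" using v by (auto simp: walks_into_def)
  thus ?thesis by blast
qed

end

section \<open>Growth in the hop recurrence\<close>

text \<open>For \<open>q = d - 1\<close> this is the adjacency operator of the
  \<open>d\<close>-regular tree, acting on sums over the spheres around a root with
  \<open>q + 1\<close> children.\<close>

definition hop :: "real \<Rightarrow> (nat \<Rightarrow> real) \<Rightarrow> nat \<Rightarrow> real" where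
  "hop q u k = u (Suc k) + (case k of 0 \<Rightarrow> 0 | Suc j \<Rightarrow> (if j = 0 then q + 1 else q) * u j)"

lemma hop_scale: "hop q (\<lambda>j. c * u j) k = c * hop q u k"
  by (auto simp: hop_def algebra_simps split: nat.split)

text \<open>Only the neighbours of \<open>k\<close> enter, so inequalities known in one parity class
  pass to the other.\<close>

lemma hop_mono:
  assumes "0 \<le> q" and "\<And>j. j = Suc k \<or> Suc j = k \<Longrightarrow> u j \<le> v j"
  shows "hop q u k \<le> hop q v k"
proof (cases k)
  case 0
  with assms(2)[of "Suc k"] show ?thesis by (simp add: hop_def)
next
  case (Suc j)
  with assms(2)[of "Suc k"] assms(2)[of j] assms(1) show ?thesis
    by (auto simp: hop_def intro!: add_mono mult_left_mono)
qed

text \<open>The boundary coefficient \<open>q + 1\<close> exceeds \<open>q\<close>, so for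
  nonnegative \<open>u\<close> the recurrence with constant coefficients is a lower bound.\<close>

lemma hop_lower:
  assumes "0 \<le> q" "\<And>k. 0 \<le> u k"
  shows "u (Suc (Suc k)) + q * u k \<le> hop q u (Suc k)"
  using assms by (auto simp: hop_def algebra_simps)

text \<open>The eigenvalue of the constant-coefficient recurrence for the profile
  \<open>r ^ k\<close>. For positive \<open>q\<close> and \<open>r\<close> it is shared by
  \<open>r\<close> and \<open>q / r\<close>.\<close>

definition level :: "real \<Rightarrow> real \<Rightarrow> real" where
  "level q r = r + q / r"

text \<open>The two levels differ by \<open>(s - r) * (r * s - q) / (r * s)\<close>, and
  \<open>q \<le> r * r < r * s\<close>.\<close>

lemma level_strict_mono:
  assumes "0 < q" "sqrt q \<le> r" "r < s"
  shows "level q r < level q s"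
proof -
  have r: "0 < r" using assms by (meson order_less_le_trans real_sqrt_gt_zero)
  have "q = sqrt q * sqrt q" using assms by simp
  also have "\<dots> \<le> r * r" using assms r by (intro mult_mono) auto
  also have "\<dots> < r * s" using assms r by simp
  finally have "q < r * s" .
  hence "0 < (s - r) * (r * s - q) / (r * s)" using assms r by simp
  also have "\<dots> = level q s - level q r"
    using assms r by (simp add: level_def field_simps)
  finally show ?thesis by simp
qed

lemma continuous_level: "0 < r \<Longrightarrow> isCont (level q) r"
  unfolding level_def by (intro continuous_intros) auto

lemma level_sqrt: "0 < q \<Longrightarrow> level q (sqrt q) = 2 * sqrt q"
  by (simp add: level_def real_div_sqrt)

text \<open>The constant branch of \<open>g\<close> is the level at
  \<open>sqrt (real d - 1)\<close>, so the case distinction becomes a \<open>max\<close>.\<close>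

lemma g_eq_level:
  assumes "2 \<le> d"
  shows "g d \<alpha> = level (real d - 1) (max \<alpha> (sqrt (real d - 1)))"
  using assms by (auto simp: g_def level_sqrt max_def) (auto simp: level_def)

locale hop_system =
  fixes q :: real and N :: "nat \<Rightarrow> nat \<Rightarrow> real"
  assumes q_gt_1: "1 < q"
    and N_nonneg: "0 \<le> N k m"
    and N_Suc: "N k (Suc m) = hop q (\<lambda>j. N j m) k"
begin

section \<open>Comparison inequalities for the recurrence\<close>

lemma N_0_Suc: "N 0 (Suc m) = N 1 m"
  by (simp add: N_Suc hop_def)

lemma N_step_up: "N (Suc k) m \<le> N k (Suc m)"
  using q_gt_1 N_nonneg by (auto simp: N_Suc hop_def split: nat.split)

lemma N_step_down: "N k m \<le> N (Suc k) (Suc m)"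
proof -
  have "1 * N k m \<le> (if k = 0 then q + 1 else q) * N k m"
    using q_gt_1 by (intro mult_right_mono N_nonneg) auto
  with N_nonneg[of "Suc (Suc k)" m] show ?thesis by (simp add: N_Suc hop_def)
qed

lemma N_add_le: "N (j + k) m \<le> N k (j + m)"
proof (induction j arbitrary: k)
  case (Suc j)
  have "N (Suc j + k) m = N (j + Suc k) m" by simp
  also have "\<dots> \<le> N (Suc k) (j + m)" by (rule Suc.IH)
  also have "\<dots> \<le> N k (Suc j + m)" using N_step_up by simp
  finally show ?case .
qed simp

lemma N_le_N_0: "N k m \<le> N 0 (k + m)"
  using N_add_le[of k 0 m] by simp

text \<open>Climb to \<open>n + k\<close> by \<open>N_step_down\<close>, then give up
  \<open>n\<close> levels by \<open>N_add_le\<close>. One value \<open>N 0 l\<close> thus bounds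
  \<open>N k m\<close> from below for every \<open>k\<close>, at large \<open>m\<close> of the right
  parity.\<close>

lemma N_0_le_N: "N 0 l \<le> N k (k + 2 * n + l)"
proof -
  have *: "N 0 l \<le> N k (k + l)" for k
    by (induction k) (auto intro: order_trans[OF _ N_step_down])
  have "N 0 l \<le> N (n + k) (n + k + l)" by (rule *)
  also have "\<dots> \<le> N k (n + (n + k + l))" by (rule N_add_le)
  also have "n + (n + k + l) = k + 2 * n + l" by simp
  finally show ?thesis .
qed

text \<open>One step of the recurrence flips the parity of \<open>k\<close>, so initial bounds are
  needed in a single parity class only.\<close>

lemma supersolution:
  assumes "\<And>k. hop q u k \<le> \<mu> * u k" "0 \<le> \<mu>"
    and "\<And>k. even (k + i) \<Longrightarrow> N k 0 \<le> u k"
  shows "even (k + m + i) \<Longrightarrow> N k m \<le> u k * \<mu> ^ m"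
proof (induction m arbitrary: k)
  case (Suc m)
  have "N k (Suc m) \<le> hop q (\<lambda>j. \<mu> ^ m * u j) k"
    unfolding N_Suc using Suc.prems q_gt_1
    by (intro hop_mono order_trans[OF Suc.IH]) auto
  also have "\<dots> \<le> \<mu> ^ m * (\<mu> * u k)"
    unfolding hop_scale using assms by (intro mult_left_mono) auto
  finally show ?case by (simp add: algebra_simps)
qed (use assms in auto)

text \<open>\<open>hop_mono\<close> propagates the inequality. The starting time
  \<open>m\<^sub>0\<close> is free because the sine profile is compared with \<open>N\<close> only
  after some steps.\<close>

lemma subsolution:
  assumes "\<And>k. \<mu> * u k \<le> hop q u k" "0 \<le> \<mu>"
    and "\<And>k. even (k + m\<^sub>0 + i) \<Longrightarrow> u k \<le> N k m\<^sub>0"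
  shows "even (k + m\<^sub>0 + m + i) \<Longrightarrow> u k * \<mu> ^ m \<le> N k (m\<^sub>0 + m)"
proof (induction m arbitrary: k)
  case (Suc m)
  have "u k * \<mu> ^ Suc m = \<mu> ^ m * (\<mu> * u k)" by (simp add: algebra_simps)
  also have "\<dots> \<le> \<mu> ^ m * hop q u k"
    using assms by (intro mult_left_mono) auto
  also have "\<dots> = hop q (\<lambda>j. \<mu> ^ m * u j) k" by (simp add: hop_scale)
  also have "\<dots> \<le> hop q (\<lambda>j. N j (m\<^sub>0 + m)) k"
    using Suc.prems q_gt_1
    by (intro hop_mono order_trans[OF _ Suc.IH]) auto
  finally show ?case by (simp add: N_Suc)
qed (use assms in auto)

text \<open>For \<open>k > 0\<close> the profile \<open>u\<close> combines the solutions
  \<open>r ^ k\<close> and \<open>(q / r) ^ k\<close> of the same level. Its value at 0 carries the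
  factor \<open>q / (q + 1)\<close>, which makes the relation at \<open>k = 1\<close> exact.\<close>

lemma N_0_upper:
  assumes r: "1 < r" and C: "0 \<le> C" and N: "\<And>k. even (k + i) \<Longrightarrow> N k 0 \<le> C * r ^ k"
  shows "\<exists>D. \<forall>t. even (t + i) \<longrightarrow> N 0 t \<le> D * level q r ^ t"
proof -
  \<comment> \<open>Large enough both for \<open>1 \<le> u 0\<close> and for the inequality at
    \<open>k = 0\<close>, which amounts to
    \<open>r\<^sup>2 \<le> B * q * (r\<^sup>2 - 1) + q\<^sup>2\<close>.\<close>
  define B where "B = r\<^sup>2 * (q + 1) / (q * (r\<^sup>2 - 1))"
  define u where "u k = (if k = 0 then (1 + B) * q / (q + 1) else r ^ k + B * (q / r) ^ k)" for k
  have q: "q > 0" "q + 1 > 0" using q_gt_1 by auto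
  have r2: "r\<^sup>2 - 1 > 0" using r by (simp add: one_less_power)
  have B0: "B \<ge> 0" unfolding B_def using q r2 by simp
  have Beq: "B * (q * (r\<^sup>2 - 1)) = r\<^sup>2 * (q + 1)" unfolding B_def using q r2 by simp
  have lev: "level q r > 0" unfolding level_def using q r by (simp add: add_pos_pos)
  have u_ge: "r ^ k \<le> u k" for k
  proof (cases k)
    case 0
    have "r\<^sup>2 - 1 \<le> r\<^sup>2" by simp
    hence "1 \<le> r\<^sup>2 / (r\<^sup>2 - 1)" using r2 by simp
    also have "\<dots> = B * q / (q + 1)" using Beq q r2 by (subst frac_eq_eq) (simp_all add: mult.assoc)
    also have "\<dots> \<le> (1 + B) * q / (q + 1)" using q by (simp add: divide_right_mono)
    finally show ?thesis using 0 by (simp add: u_def)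
  qed (use B0 q r in \<open>auto simp: u_def\<close>)
  have hop: "hop q u k \<le> level q r * u k" for k
  proof -
    consider "k = 0" | "k = 1" | j where "k = Suc (Suc j)"
      by (metis One_nat_def nat.exhaust)
    thus ?thesis
    proof cases
      case 1
      have "(r\<^sup>2 + B * q) * (q + 1) \<le> (r\<^sup>2 + q) * (1 + B) * q"
        using Beq q by (simp add: algebra_simps power2_eq_square)
      hence "(r\<^sup>2 + B * q) * (q + 1) / (r * (q + 1)) \<le> (r\<^sup>2 + q) * (1 + B) * q / (r * (q + 1))"
        using q r by (intro divide_right_mono) auto
      also have "(r\<^sup>2 + B * q) * (q + 1) / (r * (q + 1)) = r + B * q / r"
        using q r by (simp add: add_divide_distrib power2_eq_square)
      also have "(r\<^sup>2 + q) * (1 + B) * q / (r * (q + 1)) = (r\<^sup>2 + q) / r * ((1 + B) * q / (q + 1))"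
        by simp
      also have "(r\<^sup>2 + q) / r = level q r"
        using r by (simp add: level_def add_divide_distrib power2_eq_square)
      finally have "r + B * q / r \<le> level q r * ((1 + B) * q / (q + 1))" .
      thus ?thesis using 1 by (simp add: hop_def u_def)
    next
      case 2
      have "hop q u 1 = r\<^sup>2 + B * (q / r)\<^sup>2 + (1 + B) * q"
        using q by (simp add: hop_def u_def power2_eq_square)
      also have "\<dots> = level q r * u 1" using r
        by (simp add: u_def level_def field_simps power2_eq_square)
      finally show ?thesis using 2 by simp
    next
      case 3
      thus ?thesis using r
        by (simp add: hop_def u_def level_def field_simps)
    qed
  qed
  have "N 0 t \<le> (C * u 0) * level q r ^ t" if "even (t + i)" for t
  proof (rule supersolution[where i = i])
    show "hop q (\<lambda>k. C * u k) k \<le> level q r * (C * u k)" for k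
      unfolding hop_scale using mult_left_mono[OF hop C] by (simp add: algebra_simps)
    show "N k 0 \<le> C * u k" if "even (k + i)" for k
      using N[OF that] mult_left_mono[OF u_ge C] by (rule order_trans)
  qed (use that lev in auto)
  thus ?thesis by blast
qed

text \<open>The difference \<open>v\<close> of two solutions of the same level is positive exactly
  beyond \<open>K\<close>, where the hypothesis on \<open>N k 0\<close> is available; cutting it off
  at 0 leaves a subsolution.\<close>

lemma N_0_lower:
  assumes r: "sqrt q < r" and N: "\<And>k. K \<le> k \<Longrightarrow> even (k + i) \<Longrightarrow> r ^ k \<le> N k 0"
  shows "\<exists>c>0. \<forall>t>K. even (t + i) \<longrightarrow> c * level q r ^ t \<le> N 0 t"
proof -
  have q: "q > 0" using q_gt_1 by auto
  have r0: "r > 0" using r q by (meson order.strict_trans real_sqrt_gt_zero)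
  have "sqrt q * sqrt q < r * r" using r r0 q by (intro mult_strict_mono) auto
  hence "q < r\<^sup>2" using q by (simp add: power2_eq_square)
  \<comment> \<open>The ratio of the roots \<open>r\<close> and \<open>q / r\<close>; the
    coefficient \<open>\<sigma> ^ K\<close> puts the zero of \<open>v\<close> at
    \<open>K\<close>.\<close>
  define \<sigma> where "\<sigma> = r\<^sup>2 / q"
  have \<sigma>: "\<sigma> > 1" unfolding \<sigma>_def using q \<open>q < r\<^sup>2\<close> by simp
  define v where "v k = r ^ k - \<sigma> ^ K * (q / r) ^ k" for k
  have r_eq: "r ^ k = \<sigma> ^ k * (q / r) ^ k" for k
    unfolding \<sigma>_def using q r0 by (simp add: power2_eq_square flip: power_mult_distrib)
  have v_eq: "v k = (\<sigma> ^ k - \<sigma> ^ K) * (q / r) ^ k" for k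
    unfolding v_def by (subst r_eq) (simp add: algebra_simps)
  have v_neg: "v k \<le> 0" if "k \<le> K" for k
    using that \<sigma> q r0 by (auto simp: v_eq intro!: mult_nonpos_nonneg power_increasing)
  have v_pos: "v k > 0" if "k > K" for k
    using that \<sigma> q r0 by (auto simp: v_eq intro!: mult_pos_pos power_strict_increasing)
  have v_le: "v k \<le> r ^ k" for k unfolding v_def using \<sigma> q r0 by simp
  have v_rec: "level q r * v (Suc k) = v (Suc (Suc k)) + q * v k" for k
    using r0 by (simp add: v_def level_def field_simps)
  \<comment> \<open>Truncation can only increase the neighbouring values, so the inequality survives
    where \<open>v\<close> is positive; elsewhere its left side is 0.\<close>
  define u where "u k = max 0 (v k)" for k
  have lev: "level q r > 0" unfolding level_def using q r0 by (simp add: add_pos_pos)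
  have u_sub: "level q r * u k \<le> hop q u k" for k
  proof (cases "v k \<le> 0")
    case True
    have "0 \<le> hop q u k" using q by (auto simp: hop_def u_def split: nat.split)
    thus ?thesis using True by (simp add: u_def)
  next
    case False
    with v_neg[of k] obtain j where j: "k = Suc j" by (cases k) auto
    have "level q r * u k = v (Suc k) + q * v j" using False v_rec by (simp add: u_def j)
    also have "\<dots> \<le> u (Suc k) + q * u j"
      using q by (intro add_mono mult_left_mono) (auto simp: u_def)
    also have "\<dots> \<le> hop q u k"
      unfolding j by (rule hop_lower) (use q in \<open>auto simp: u_def\<close>)
    finally show ?thesis .
  qed
  have u_le: "u k \<le> N k 0" if "even (k + i)" for k
    using N[OF _ that] v_le[of k] v_neg[of k] N_nonneg[of k 0]
    by (cases "K \<le> k") (auto simp: u_def)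
  \<comment> \<open>The bound is read off at \<open>Suc K\<close>, the first point of the support;
    the division pays for the \<open>Suc K\<close> steps between there and 0.\<close>
  define c where "c = u (Suc K) / level q r ^ Suc K"
  have "c > 0" using v_pos[of "Suc K"] lev by (simp add: c_def u_def)
  moreover have "c * level q r ^ t \<le> N 0 t" if t: "t > K" "even (t + i)" for t
  proof -
    have "level q r ^ t = level q r ^ Suc K * level q r ^ (t - Suc K)"
      using t by (subst power_add[symmetric]) simp
    hence "c * level q r ^ t = u (Suc K) * level q r ^ (t - Suc K)"
      using lev by (simp add: c_def)
    also have "\<dots> \<le> N (Suc K) (0 + (t - Suc K))"
      by (rule subsolution[where i = i]) (use t lev u_sub u_le in auto)
    also have "\<dots> \<le> N 0 t" using N_le_N_0[of "Suc K" "t - Suc K"] t by simp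
    finally show ?thesis .
  qed
  ultimately show ?thesis by blast
qed

text \<open>The profile \<open>u\<close> is a Dirichlet eigenfunction on \<open>{0..L}\<close> of
  the constant-coefficient recurrence, extended by 0. Its eigenvalue
  \<open>2 * sqrt q * cos (pi / L)\<close> tends to \<open>2 * sqrt q\<close> as \<open>L\<close>
  grows.\<close>

lemma N_0_lower_spectral:
  assumes l: "0 < N 0 l" and \<kappa>: "\<kappa> < 2 * sqrt q"
  shows "\<exists>\<mu>>\<kappa>. \<mu> > 0 \<and> (\<exists>c>0. \<exists>T. \<forall>t>T. even (t + l) \<longrightarrow> c * \<mu> ^ t \<le> N 0 t)"
proof -
  define \<rho> where "\<rho> = sqrt q"
  have \<rho>: "\<rho> > 1" "\<rho> * \<rho> = q" unfolding \<rho>_def using q_gt_1 by auto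
  have "(\<lambda>n. 2 * \<rho> * cos (pi / real n)) \<longlonglongrightarrow> 2 * \<rho> * cos 0"
    by (intro tendsto_intros isCont_tendsto_compose[OF isCont_cos] real_tendsto_divide_at_top[where c = pi] filterlim_real_sequentially)
  hence "\<forall>\<^sub>F n in sequentially. \<kappa> < 2 * \<rho> * cos (pi / real n)"
    using \<kappa> by (intro order_tendstoD) (auto simp: \<rho>_def)
  \<comment> \<open>\<open>L \<ge> 3\<close> keeps \<open>pi / L\<close> below
    \<open>pi / 2\<close>, so that the eigenvalue is positive.\<close>
  then obtain L where L: "L \<ge> 3" "\<kappa> < 2 * \<rho> * cos (pi / real L)"
    using eventually_happens[OF eventually_conj[OF _ eventually_ge_at_top[of 3]]] by force
  define \<theta> where "\<theta> = pi / real L"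
  have \<theta>: "0 < \<theta>" "\<theta> < pi / 2" "real L * \<theta> = pi"
    using L(1) by (auto simp: \<theta>_def field_simps)
  define \<mu> where "\<mu> = 2 * \<rho> * cos \<theta>"
  have \<mu>: "\<mu> > \<kappa>" "\<mu> > 0"
    using L \<theta> \<rho> cos_gt_zero[of \<theta>] by (auto simp: \<mu>_def \<theta>_def)
  define u where "u k = (if k \<le> L then \<rho> ^ k * sin (real k * \<theta>) else 0)" for k
  have sin_nonneg: "sin (real k * \<theta>) \<ge> 0" if "k \<le> L" for k
  proof (rule sin_ge_zero)
    have "real k * \<theta> \<le> real L * \<theta>" using that \<theta> by (intro mult_right_mono) auto
    thus "real k * \<theta> \<le> pi" using \<theta> by simp
  qed (use \<theta> in auto)
  have u0: "0 \<le> u k" for k using sin_nonneg \<rho> by (auto simp: u_def)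
  have u_sub: "\<mu> * u k \<le> hop q u k" for k
  proof (cases "0 < k \<and> k < L")
    case False
    have "u k = 0" using False \<theta>(3) by (auto simp: u_def not_less le_less)
    moreover have "0 \<le> hop q u k" using q_gt_1 u0 by (auto simp: hop_def split: nat.split)
    ultimately show ?thesis by simp
  next
    case True
    then obtain j where j: "k = Suc j" by (cases k) auto
    have "sin (real (Suc k) * \<theta>) + sin (real j * \<theta>) = 2 * cos \<theta> * sin (real k * \<theta>)"
    proof -
      have "real (Suc k) * \<theta> = real k * \<theta> + \<theta>" "real j * \<theta> = real k * \<theta> - \<theta>"
        by (simp_all add: j algebra_simps)
      thus ?thesis by (simp only: sin_add sin_diff) simp
    qed
    moreover have "u (Suc k) + q * u j
        = \<rho> ^ Suc k * (sin (real (Suc k) * \<theta>) + sin (real j * \<theta>))"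
      using True \<rho>(2)[symmetric] by (simp add: u_def j algebra_simps)
    ultimately have "u (Suc k) + q * u j = \<mu> * u k"
      using True by (simp add: u_def \<mu>_def)
    thus ?thesis using hop_lower[of q u j] q_gt_1 u0 by (simp add: j)
  qed
  define c where "c = N 0 l / \<rho> ^ L"
  have c: "c > 0" using l \<rho> by (simp add: c_def)
  have base: "c * u k \<le> N k (L + l)" if e: "even (k + (L + l) + l)" for k
  proof (cases "k \<le> L")
    case True
    have "u k \<le> \<rho> ^ L * 1"
      unfolding u_def using True \<rho> sin_nonneg[of k]
      by (simp only: if_True) (intro mult_mono power_increasing, auto)
    hence "c * u k \<le> c * \<rho> ^ L" using c by simp
    also have "\<dots> = N 0 l" using \<rho> by (simp add: c_def)
    also have "\<dots> \<le> N k (k + 2 * ((L - k) div 2) + l)" by (rule N_0_le_N)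
    \<comment> \<open>The parity hypothesis makes \<open>L - k\<close> even, so the division is
      exact.\<close>
    also have "k + 2 * ((L - k) div 2) = L" using e True by presburger
    finally show ?thesis .
  qed (use N_nonneg in \<open>auto simp: u_def\<close>)
  have sub: "\<mu> * (c * u k) \<le> hop q (\<lambda>k. c * u k) k" for k
    unfolding hop_scale using mult_left_mono[OF u_sub, of c k] c by (simp add: algebra_simps)
  \<comment> \<open>As \<open>u 0 = 0\<close>, the bound is read off at 1 and carried to 0 by
    \<open>N_0_Suc\<close>; hence the extra step in \<open>Suc (L + l)\<close> below.\<close>
  have u1: "u 1 > 0" using L \<theta> \<rho> by (simp add: u_def sin_gt_zero2)
  define D where "D = c * u 1 / \<mu> ^ Suc (L + l)"
  have "D * \<mu> ^ t \<le> N 0 t" if t: "t > L + l" "even (t + l)" for t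
  proof -
    have "\<mu> ^ t = \<mu> ^ Suc (L + l) * \<mu> ^ (t - Suc (L + l))"
      using t by (subst power_add[symmetric]) simp
    hence "D * \<mu> ^ t = c * u 1 * \<mu> ^ (t - Suc (L + l))"
      using \<mu> by (simp add: D_def)
    also have "\<dots> \<le> N 1 ((L + l) + (t - Suc (L + l)))"
      by (rule subsolution[where i = l and u = "\<lambda>k. c * u k"])
        (use t \<mu> sub base in auto)
    also have "\<dots> = N 0 t" using t N_0_Suc[of "t - 1"] by simp
    finally show ?thesis .
  qed
  moreover have "D > 0" using c u1 \<mu> by (simp add: D_def)
  ultimately show ?thesis using \<mu> by blast
qed

text \<open>In terms of \<open>H k = (\<Sum>m. N k m / \<mu> ^ m)\<close> the recurrence becomes
  \<open>\<mu> * H k = \<mu> * N k 0 + hop q H k\<close>; for \<open>\<mu> = level q s\<close> its characteristic roots are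
  \<open>s\<close> and \<open>q / s\<close>, so that \<open>H\<close> grows at most like \<open>s ^ k\<close>.\<close>

lemma N_initial_upper:
  assumes s: "sqrt q \<le> s'" "s' < s" and N: "\<And>t. N 0 t \<le> C * level q s' ^ t"
  shows "\<exists>D. \<forall>k. N k 0 \<le> D * s ^ k"
proof -
  have q: "q > 0" using q_gt_1 by auto
  have s'0: "s' > 0" using s q by (meson less_le_trans real_sqrt_gt_zero)
  have s0: "s > 0" using s s'0 by linarith
  define \<mu> where "\<mu> = level q s"
  define \<nu> where "\<nu> = level q s'"
  have \<nu>\<mu>: "0 < \<nu>" "\<nu> < \<mu>"
    using level_strict_mono[of q s' s] s q s'0 by (auto simp: \<mu>_def \<nu>_def level_def add_pos_pos)
  have \<mu>0: "\<mu> > 0" using \<nu>\<mu> by linarith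
  have sq: "q < s * s"
  proof -
    have "q = sqrt q * sqrt q" using q by simp
    also have "\<dots> < s * s" using s s0 q by (intro mult_strict_mono) auto
    finally show ?thesis .
  qed
  define H where "H k = (\<Sum>m. N k m / \<mu> ^ m)" for k
  \<comment> \<open>\<open>N k m \<le> N 0 (k + m)\<close> and the gap \<open>\<nu> < \<mu>\<close>
    give a geometric majorant.\<close>
  have summ: "summable (\<lambda>m. N k m / \<mu> ^ m)" for k
  proof (rule summable_comparison_test)
    show "summable (\<lambda>m. C * \<nu> ^ k * (\<nu> / \<mu>) ^ m)"
      using \<nu>\<mu> by (intro summable_mult summable_geometric) simp
    have "norm (N k m / \<mu> ^ m) \<le> C * \<nu> ^ k * (\<nu> / \<mu>) ^ m" for m
    proof -
      have "N k m \<le> C * \<nu> ^ (k + m)"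
        using order_trans[OF N_le_N_0 N] by (simp add: \<nu>_def)
      thus ?thesis using N_nonneg[of k m] \<mu>0
        by (simp add: power_add power_divide divide_right_mono mult.assoc)
    qed
    thus "\<exists>M. \<forall>m\<ge>M. norm (N k m / \<mu> ^ m) \<le> C * \<nu> ^ k * (\<nu> / \<mu>) ^ m" by blast
  qed
  have H0: "0 \<le> H k" for k
    unfolding H_def using \<mu>0 N_nonneg by (intro suminf_nonneg summ) auto
  have split: "H k = N k 0 + (\<Sum>m. N k (Suc m) / \<mu> ^ m) / \<mu>" for k
  proof -
    have "(\<lambda>m. N k (Suc m) / \<mu> ^ Suc m) sums (H k - N k 0)"
      using summable_sums[OF summ[of k]]
      by (subst sums_Suc_iff) (simp add: H_def)
    hence "(\<lambda>m. \<mu> * (N k (Suc m) / \<mu> ^ Suc m)) sums (\<mu> * (H k - N k 0))"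
      by (rule sums_mult)
    hence "(\<lambda>m. N k (Suc m) / \<mu> ^ m) sums (\<mu> * (H k - N k 0))"
      using \<mu>0 by simp
    thus ?thesis using \<mu>0 by (simp add: sums_iff)
  qed
  have rec: "H (Suc (Suc k)) \<le> \<mu> * H (Suc k) - q * H k" for k
  proof -
    have "H (Suc (Suc k)) + q * H k
        = (\<Sum>m. N (Suc (Suc k)) m / \<mu> ^ m + q * (N k m / \<mu> ^ m))"
      unfolding H_def
      by (simp only: suminf_mult[OF summ, symmetric] suminf_add[OF summ summable_mult[OF summ]])
    also have "\<dots> \<le> (\<Sum>m. N (Suc k) (Suc m) / \<mu> ^ m)"
    proof (rule suminf_le)
      show "N (Suc (Suc k)) m / \<mu> ^ m + q * (N k m / \<mu> ^ m) \<le> N (Suc k) (Suc m) / \<mu> ^ m" for m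
        using hop_lower[of q "\<lambda>j. N j m" k] N_nonneg q \<mu>0
        by (simp add: N_Suc divide_right_mono flip: add_divide_distrib)
      show "summable (\<lambda>m. N (Suc (Suc k)) m / \<mu> ^ m + q * (N k m / \<mu> ^ m))"
        by (intro summable_add summable_mult summ)
      have "summable (\<lambda>m. \<mu> * (N (Suc k) (Suc m) / \<mu> ^ Suc m))"
        by (intro summable_mult) (use summ[of "Suc k"] in \<open>subst summable_Suc_iff\<close>)
      thus "summable (\<lambda>m. N (Suc k) (Suc m) / \<mu> ^ m)" using \<mu>0 by simp
    qed
    also have "\<dots> = \<mu> * (H (Suc k) - N (Suc k) 0)"
      using split[of "Suc k"] \<mu>0 by simp
    also have "\<dots> \<le> \<mu> * H (Suc k)" using \<mu>0 N_nonneg by simp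
    finally show ?thesis by simp
  qed
  \<comment> \<open>Subtracting \<open>q / s\<close> times the previous term turns the second-order
    inequality into a first-order one with ratio \<open>s\<close>.\<close>
  define X where "X = \<bar>H 1 - q / s * H 0\<bar>"
  have X: "H (Suc k) - q / s * H k \<le> X * s ^ k" for k
  proof (induction k)
    case (Suc k)
    have "H (Suc (Suc k)) - q / s * H (Suc k) \<le> \<mu> * H (Suc k) - q * H k - q / s * H (Suc k)"
      using rec[of k] by simp
    also have "\<dots> = s * (H (Suc k) - q / s * H k)"
      using s0 by (simp add: \<mu>_def level_def field_simps)
    also have "\<dots> \<le> s * (X * s ^ k)" using Suc.IH s0 by simp
    finally show ?case by (simp add: algebra_simps)
  qed (simp add: X_def abs_ge_self)
  have gap: "s - q / s > 0" using sq s0 by (simp add: field_simps)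
  \<comment> \<open>The first entry covers \<open>k = 0\<close>; the second gives
    \<open>X \<le> E * (s - q / s)\<close>, which closes the induction.\<close>
  define E where "E = max (H 0) (X / (s - q / s))"
  have "H k \<le> E * s ^ k" for k
  proof (induction k)
    case (Suc k)
    have "X \<le> E * (s - q / s)" using gap by (simp add: E_def flip: pos_divide_le_eq)
    hence "X * s ^ k \<le> E * (s - q / s) * s ^ k" using s0 by (intro mult_right_mono) auto
    moreover have "q / s * H k \<le> q / s * (E * s ^ k)"
      using Suc.IH q s0 by (intro mult_left_mono) auto
    ultimately have "H (Suc k) \<le> q / s * (E * s ^ k) + E * (s - q / s) * s ^ k"
      using X[of k] by linarith
    also have "\<dots> = E * s ^ Suc k" by (simp add: algebra_simps)
    finally show ?case .
  qed (simp add: E_def)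
  moreover have "N k 0 \<le> H k" for k
    using sum_le_suminf[OF summ[of k], of "{0}"] \<mu>0 N_nonneg by (simp add: H_def)
  ultimately show ?thesis by (meson order_trans)
qed

end

section \<open>Growth rates\<close>

lemma parity_eventually:
  assumes "i \<le> 1"
  shows "(\<forall>\<^sub>F t in sequentially. even (t + i) \<longrightarrow> P t)
    \<longleftrightarrow> (\<forall>\<^sub>F n in sequentially. P (2 * n + i))" (is "?L \<longleftrightarrow> ?R")
proof
  assume ?L
  then obtain T where "\<And>t. T \<le> t \<Longrightarrow> even (t + i) \<Longrightarrow> P t"
    by (auto simp: eventually_sequentially)
  hence "P (2 * n + i)" if "T \<le> n" for n using that by simp
  thus ?R by (auto simp: eventually_sequentially)
next
  assume ?R
  then obtain T where T: "\<And>n. T \<le> n \<Longrightarrow> P (2 * n + i)"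
    by (auto simp: eventually_sequentially)
  have "P t" if t: "2 * T + 1 \<le> t" "even (t + i)" for t
  proof -
    have "t = 2 * ((t - i) div 2) + i" "T \<le> (t - i) div 2"
      using t assms by presburger+
    thus ?thesis using T by metis
  qed
  thus ?L by (auto simp: eventually_sequentially)
qed

lemma eventually_both_parities:
  assumes "\<And>i. \<forall>\<^sub>F t in sequentially. even (t + i) \<longrightarrow> P t"
  shows "eventually P sequentially"
  using assms[of 0] assms[of 1] by eventually_elim auto

lemma eventually_root_less:
  assumes f: "\<And>t. even (t + i) \<Longrightarrow> f t \<le> D * \<mu> ^ t" and \<mu>: "0 < \<mu>" "\<mu> < \<nu>"
  shows "\<forall>\<^sub>F t in sequentially. even (t + i) \<longrightarrow> root t (f t) < \<nu>"
proof -
  have gt: "1 < \<nu> / \<mu>" using \<mu> by simp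
  then obtain n where n: "D < (\<nu> / \<mu>) ^ n" using real_arch_pow by blast
  have "root t (f t) < \<nu>" if t: "Suc n \<le> t" "even (t + i)" for t
  proof -
    have "D < (\<nu> / \<mu>) ^ t"
      using n gt t by (intro less_le_trans[OF n power_increasing]) auto
    hence "D * \<mu> ^ t < \<nu> ^ t" using \<mu> by (simp add: power_divide pos_less_divide_eq)
    with f[OF t(2)] have "f t < \<nu> ^ t" by simp
    hence "root t (f t) < root t (\<nu> ^ t)" using t by (intro real_root_less_mono) auto
    thus ?thesis using t \<mu> by (simp add: real_root_power_cancel)
  qed
  thus ?thesis by (auto simp: eventually_sequentially)
qed

lemma eventually_root_greater:
  assumes f: "\<And>t. T < t \<Longrightarrow> even (t + i) \<Longrightarrow> c * \<mu> ^ t \<le> f t" "\<And>t. 0 \<le> f t"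
    and \<mu>: "0 < c" "0 < \<mu>" "\<nu> < \<mu>"
  shows "\<forall>\<^sub>F t in sequentially. even (t + i) \<longrightarrow> \<nu> < root t (f t)"
proof -
  \<comment> \<open>\<open>\<nu>\<close> may be negative; a positive rate between it and
    \<open>\<mu>\<close> is inserted so that the root cancels the power.\<close>
  define \<kappa> where "\<kappa> = (max \<nu> 0 + \<mu>) / 2"
  have \<kappa>: "0 < \<kappa>" "\<nu> < \<kappa>" "\<kappa> < \<mu>" using \<mu> by (auto simp: \<kappa>_def)
  have lt: "\<kappa> / \<mu> < 1" "0 \<le> \<kappa> / \<mu>" using \<mu> \<kappa> by auto
  then obtain n where n: "(\<kappa> / \<mu>) ^ n < c" using real_arch_pow_inv \<mu> by blast
  have "\<nu> < root t (f t)" if t: "Suc (n + T) \<le> t" "even (t + i)" for t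
  proof -
    have "(\<kappa> / \<mu>) ^ t < c"
      using n power_decreasing[of n t "\<kappa> / \<mu>"] lt t by simp
    hence "\<kappa> ^ t \<le> c * \<mu> ^ t" using \<mu> by (simp add: power_divide pos_divide_less_eq)
    with f(1)[OF _ t(2)] t(1) have "\<kappa> ^ t \<le> f t" by simp
    hence "root t (\<kappa> ^ t) \<le> root t (f t)" using t by (intro real_root_le_mono) auto
    thus ?thesis using t \<kappa> by (simp add: real_root_power_cancel)
  qed
  thus ?thesis by (auto simp: eventually_sequentially)
qed

section \<open>Limits and limits superior of the roots\<close>

context hop_system
begin

lemma q_pos: "0 < q" and sqrt_q: "1 < sqrt q"
  using q_gt_1 by auto

text \<open>By right-continuity of \<open>level\<close> some
  \<open>r > max \<alpha> (sqrt q)\<close> still has level below \<open>\<nu>\<close>; the eventual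
  bound by \<open>r\<close> on the roots feeds \<open>N_0_upper\<close>.\<close>

lemma root_upper:
  assumes a: "\<And>r. \<alpha> < r \<Longrightarrow> \<forall>\<^sub>F t in sequentially. even (t + i) \<longrightarrow> root t (N t 0) < r"
    and \<nu>: "level q (max \<alpha> (sqrt q)) < \<nu>"
  shows "\<forall>\<^sub>F t in sequentially. even (t + i) \<longrightarrow> root t (N 0 t) < \<nu>"
proof -
  define M where "M = max \<alpha> (sqrt q)"
  have M: "\<alpha> \<le> M" "sqrt q \<le> M" "M > 1" using sqrt_q by (simp_all add: M_def less_max_iff_disj)
  have "(level q \<longlongrightarrow> level q M) (at_right M)"
    using continuous_level[of M q] M unfolding isCont_def by (auto intro: tendsto_within_subset)
  hence "\<forall>\<^sub>F r in at_right M. level q r < \<nu>"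
    using \<nu> by (intro order_tendstoD) (simp add: M_def)
  hence "\<forall>\<^sub>F r in at_right M. M < r \<and> level q r < \<nu>"
    using eventually_at_right_less[of M] by eventually_elim simp
  then obtain r where r: "M < r" "level q r < \<nu>"
    using eventually_happens'[OF trivial_limit_at_right_real] by blast
  have "\<forall>\<^sub>F t in sequentially. even (t + i) \<longrightarrow> root t (N t 0) < r"
    using a r M by simp
  then obtain K where K: "\<And>t. K \<le> t \<Longrightarrow> even (t + i) \<Longrightarrow> root t (N t 0) < r"
    by (auto simp: eventually_sequentially)
  \<comment> \<open>Since \<open>r > 1\<close>, adding the early terms makes the bound hold for all
    \<open>k\<close> of the given parity.\<close>
  define C where "C = 1 + (\<Sum>k\<le>K. N k 0)"
  have C: "1 \<le> C" using N_nonneg by (simp add: C_def sum_nonneg)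
  have "N k 0 \<le> C * r ^ k" if e: "even (k + i)" for k
  proof (cases "K < k")
    case True
    have "N k 0 = root k (N k 0) ^ k" using True N_nonneg by simp
    also have "\<dots> \<le> r ^ k" using K[of k] True e N_nonneg by (intro power_mono) auto
    also have "\<dots> \<le> C * r ^ k" using C r M by (simp add: mult_le_cancel_right1)
    finally show ?thesis .
  next
    case False
    hence "N k 0 \<le> (\<Sum>k\<le>K. N k 0)" using N_nonneg by (intro member_le_sum) auto
    also have "\<dots> \<le> C * 1" by (simp add: C_def)
    also have "\<dots> \<le> C * r ^ k" using C r M by (intro mult_left_mono one_le_power) auto
    finally show ?thesis .
  qed
  then obtain D where "\<And>t. even (t + i) \<Longrightarrow> N 0 t \<le> D * level q r ^ t"
    using N_0_upper[of r C i] r M C by auto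
  moreover have "0 < level q r" using r M q_pos by (simp add: level_def add_pos_pos)
  ultimately show ?thesis using r by (intro eventually_root_less) auto
qed

lemma root_lower_spectral:
  assumes l: "0 < N 0 l" "even (l + i)" and \<nu>: "\<nu> < 2 * sqrt q"
  shows "\<forall>\<^sub>F t in sequentially. even (t + i) \<longrightarrow> \<nu> < root t (N 0 t)"
proof -
  from N_0_lower_spectral[OF l(1) \<nu>] obtain \<mu> c T where
    *: "\<nu> < \<mu>" "0 < \<mu>" "0 < c" "\<And>t. T < t \<Longrightarrow> even (t + l) \<Longrightarrow> c * \<mu> ^ t \<le> N 0 t" by blast
  have "c * \<mu> ^ t \<le> N 0 t" if "T < t" "even (t + i)" for t
    by (rule *(4)) (use that l(2) in auto)
  thus ?thesis using *(1-3) N_nonneg by (intro eventually_root_greater[of T i c \<mu>]) auto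
qed

text \<open>Left-continuity of \<open>level\<close> at \<alpha>.\<close>

lemma obtain_level_between:
  assumes "sqrt q < \<alpha>" "\<nu> < level q \<alpha>"
  obtains r where "sqrt q < r" "r < \<alpha>" "\<nu> < level q r"
proof -
  have \<alpha>: "0 < \<alpha>" using assms sqrt_q by linarith
  have "(level q \<longlongrightarrow> level q \<alpha>) (at_left \<alpha>)"
    using continuous_level[OF \<alpha>, of q] unfolding isCont_def by (auto intro: tendsto_within_subset)
  hence "\<forall>\<^sub>F r in at_left \<alpha>. \<nu> < level q r"
    using assms by (intro order_tendstoD)
  moreover have "\<forall>\<^sub>F r in at_left \<alpha>. r \<in> {sqrt q<..<\<alpha>}"
    using assms by (intro eventually_at_leftI)
  ultimately have "\<forall>\<^sub>F r in at_left \<alpha>. sqrt q < r \<and> r < \<alpha> \<and> \<nu> < level q r"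
    by eventually_elim simp
  thus ?thesis
    using that eventually_happens'[OF trivial_limit_at_left_real] by blast
qed

text \<open>For \<open>\<alpha> \<le> sqrt q\<close> the spectral bound suffices; otherwise a rate
  \<open>r\<close> just below \<alpha> is fed to \<open>N_0_lower\<close>.\<close>

lemma root_lower:
  assumes a: "\<And>r. r < \<alpha> \<Longrightarrow> \<forall>\<^sub>F t in sequentially. even (t + i) \<longrightarrow> r < root t (N t 0)"
    and l: "0 < N 0 l" "even (l + i)" and \<nu>: "\<nu> < level q (max \<alpha> (sqrt q))"
  shows "\<forall>\<^sub>F t in sequentially. even (t + i) \<longrightarrow> \<nu> < root t (N 0 t)"
proof (cases "\<alpha> \<le> sqrt q")
  case True
  with \<nu> q_pos show ?thesis
    by (intro root_lower_spectral[OF l]) (simp add: max_def level_sqrt)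
next
  case False
  with \<nu> have "sqrt q < \<alpha>" "\<nu> < level q \<alpha>" by (simp_all add: max_def)
  then obtain r where r: "sqrt q < r" "r < \<alpha>" "\<nu> < level q r"
    by (rule obtain_level_between)
  have r0: "0 < r" using r sqrt_q by linarith
  from a[OF r(2)] obtain K where K: "\<And>t. K \<le> t \<Longrightarrow> even (t + i) \<Longrightarrow> r < root t (N t 0)"
    by (auto simp: eventually_sequentially)
  have "r ^ k \<le> N k 0" if k: "Suc K \<le> k" "even (k + i)" for k
  proof -
    have "r ^ k \<le> root k (N k 0) ^ k" using K[of k] k r0 by (intro power_mono) auto
    thus ?thesis using k N_nonneg by simp
  qed
  from N_0_lower[OF r(1) this] obtain c where
    "0 < c" "\<And>t. Suc K < t \<Longrightarrow> even (t + i) \<Longrightarrow> c * level q r ^ t \<le> N 0 t" by blast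
  moreover have "0 < level q r" using r0 q_pos by (simp add: level_def add_pos_pos)
  ultimately show ?thesis using r N_nonneg by (intro eventually_root_greater) auto
qed

text \<open>\<open>N 0 t\<close> is determined by the \<open>N k 0\<close> with \<open>k\<close> of
  the parity of \<open>t\<close>, so the formula holds in each parity class separately.\<close>

lemma root_tendsto_parity:
  assumes i: "i \<le> 1" and lim: "(\<lambda>n. root (2 * n + i) (N (2 * n + i) 0)) \<longlonglongrightarrow> \<alpha>"
    and l: "0 < N 0 l" "even (l + i)"
  shows "(\<lambda>n. root (2 * n + i) (N 0 (2 * n + i))) \<longlonglongrightarrow> level q (max \<alpha> (sqrt q))"
proof (rule order_tendstoI)
  fix \<nu> assume "\<nu> < level q (max \<alpha> (sqrt q))"
  moreover have "\<forall>\<^sub>F t in sequentially. even (t + i) \<longrightarrow> r < root t (N t 0)" if "r < \<alpha>" for r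
    unfolding parity_eventually[OF i] by (rule order_tendstoD(1)[OF lim that])
  ultimately have "\<forall>\<^sub>F t in sequentially. even (t + i) \<longrightarrow> \<nu> < root t (N 0 t)"
    by (intro root_lower[OF _ l])
  thus "\<forall>\<^sub>F n in sequentially. \<nu> < root (2 * n + i) (N 0 (2 * n + i))"
    unfolding parity_eventually[OF i] .
next
  fix \<nu> assume "level q (max \<alpha> (sqrt q)) < \<nu>"
  moreover have "\<forall>\<^sub>F t in sequentially. even (t + i) \<longrightarrow> root t (N t 0) < r" if "\<alpha> < r" for r
    unfolding parity_eventually[OF i] by (rule order_tendstoD(2)[OF lim that])
  ultimately have "\<forall>\<^sub>F t in sequentially. even (t + i) \<longrightarrow> root t (N 0 t) < \<nu>"
    by (intro root_upper)
  thus "\<forall>\<^sub>F n in sequentially. root (2 * n + i) (N 0 (2 * n + i)) < \<nu>"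
    unfolding parity_eventually[OF i] .
qed

lemma root_tendsto:
  assumes lim: "(\<lambda>t. root t (N t 0)) \<longlonglongrightarrow> \<alpha>"
    and l: "0 < N 0 l" "even l" and l': "0 < N 0 l'" "odd l'"
  shows "(\<lambda>t. root t (N 0 t)) \<longlonglongrightarrow> level q (max \<alpha> (sqrt q))"
proof (rule order_tendstoI)
  fix \<nu> assume \<nu>: "\<nu> < level q (max \<alpha> (sqrt q))"
  have "\<forall>\<^sub>F t in sequentially. even (t + i) \<longrightarrow> r < root t (N t 0)" if "r < \<alpha>" for r i
    using order_tendstoD(1)[OF lim that] by eventually_elim simp
  hence "\<forall>\<^sub>F t in sequentially. even (t + i) \<longrightarrow> \<nu> < root t (N 0 t)" for i
    using l l' by (intro root_lower[OF _ _ _ \<nu>, where l = "if even i then l else l'"]) simp_all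
  thus "\<forall>\<^sub>F t in sequentially. \<nu> < root t (N 0 t)" by (rule eventually_both_parities)
next
  fix \<nu> assume \<nu>: "level q (max \<alpha> (sqrt q)) < \<nu>"
  have "\<forall>\<^sub>F t in sequentially. even (t + i) \<longrightarrow> root t (N t 0) < r" if "\<alpha> < r" for r i
    using order_tendstoD(2)[OF lim that] by eventually_elim simp
  hence "\<forall>\<^sub>F t in sequentially. even (t + i) \<longrightarrow> root t (N 0 t) < \<nu>" for i
    by (intro root_upper[OF _ \<nu>])
  thus "\<forall>\<^sub>F t in sequentially. root t (N 0 t) < \<nu>" by (rule eventually_both_parities)
qed

text \<open>The lower half cannot use \<open>root_lower\<close>, as the roots of
  \<open>N t 0\<close> may come near \<alpha> only rarely. Instead, if \<open>N 0 t\<close> grew too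
  slowly, \<open>N_initial_upper\<close> would force \<open>N k 0\<close> to grow at a rate below
  \<alpha>.\<close>

lemma root_limsup:
  assumes lim: "limsup (\<lambda>t. ereal (root t (N t 0))) = ereal \<alpha>" and l: "0 < N 0 l"
  shows "limsup (\<lambda>t. ereal (root t (N 0 t))) = ereal (level q (max \<alpha> (sqrt q)))"
proof (rule antisym)
  show "limsup (\<lambda>t. ereal (root t (N 0 t))) \<le> ereal (level q (max \<alpha> (sqrt q)))"
  proof (rule ccontr)
    assume "\<not> ?thesis"
    hence "ereal (level q (max \<alpha> (sqrt q))) < limsup (\<lambda>t. ereal (root t (N 0 t)))"
      by (simp only: not_le)
    from ereal_dense2[OF this] obtain \<nu> where "ereal (level q (max \<alpha> (sqrt q))) < ereal \<nu>"
      and less: "ereal \<nu> < limsup (\<lambda>t. ereal (root t (N 0 t)))" by blast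
    hence \<nu>: "level q (max \<alpha> (sqrt q)) < \<nu>" by (simp only: less_ereal.simps)
    have "\<forall>\<^sub>F t in sequentially. even (t + i) \<longrightarrow> root t (N t 0) < r" if "\<alpha> < r" for r i
    proof -
      have "\<forall>\<^sub>F t in sequentially. ereal (root t (N t 0)) < ereal r"
        using lim that by (intro Limsup_lessD) simp
      thus ?thesis by eventually_elim simp
    qed
    hence "\<forall>\<^sub>F t in sequentially. even (t + i) \<longrightarrow> root t (N 0 t) < \<nu>" for i
      by (intro root_upper[OF _ \<nu>])
    hence "\<forall>\<^sub>F t in sequentially. root t (N 0 t) < \<nu>" by (rule eventually_both_parities)
    hence "limsup (\<lambda>t. ereal (root t (N 0 t))) \<le> ereal \<nu>"
      by (intro Limsup_bounded) (auto elim: eventually_mono)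
    with less show False by simp
  qed
  show "ereal (level q (max \<alpha> (sqrt q))) \<le> limsup (\<lambda>t. ereal (root t (N 0 t)))"
  proof (rule ccontr)
    assume "\<not> ?thesis"
    hence "limsup (\<lambda>t. ereal (root t (N 0 t))) < ereal (level q (max \<alpha> (sqrt q)))"
      by (simp only: not_le)
    from ereal_dense2[OF this] obtain \<nu> where "ereal \<nu> < ereal (level q (max \<alpha> (sqrt q)))"
      and less: "limsup (\<lambda>t. ereal (root t (N 0 t))) < ereal \<nu>" by blast
    hence \<nu>: "\<nu> < level q (max \<alpha> (sqrt q))" by (simp only: less_ereal.simps)
    have b: "\<forall>\<^sub>F t in sequentially. root t (N 0 t) < \<nu>"
      using Limsup_lessD[OF less] by simp
    \<comment> \<open>A smaller \<open>\<nu>\<close> would contradict the spectral bound at large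
      \<open>t\<close> of the parity of \<open>l\<close>.\<close>
    have spectral: "2 * sqrt q \<le> \<nu>"
    proof (rule ccontr)
      assume "\<not> 2 * sqrt q \<le> \<nu>"
      hence "\<forall>\<^sub>F t in sequentially. even (t + l) \<longrightarrow> \<nu> < root t (N 0 t)"
        using l by (intro root_lower_spectral[of l]) auto
      with b have "\<forall>\<^sub>F t in sequentially. odd (t + l)"
        by eventually_elim auto
      then obtain T where "\<And>t. T \<le> t \<Longrightarrow> odd (t + l)" by (auto simp: eventually_sequentially)
      from this[of "l + 2 * T"] show False by simp
    qed
    have "sqrt q < \<alpha>"
      using spectral \<nu> level_sqrt[OF q_pos] by (cases "\<alpha> \<le> sqrt q") (auto simp: max_def)
    moreover from this \<nu> have "\<nu> < level q \<alpha>" by (simp add: max_def)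
    ultimately obtain s where s: "sqrt q < s" "s < \<alpha>" "\<nu> < level q s"
      by (rule obtain_level_between)
    obtain T where T: "\<And>t. T \<le> t \<Longrightarrow> root t (N 0 t) < \<nu>"
      using b by (auto simp: eventually_sequentially)
    have lev: "1 \<le> level q s" using spectral sqrt_q s by linarith
    define C where "C = 1 + (\<Sum>t\<le>T. N 0 t)"
    have C: "1 \<le> C" using N_nonneg by (simp add: C_def sum_nonneg)
    have "N 0 t \<le> C * level q s ^ t" for t
    proof (cases "T < t")
      case True
      have "N 0 t = root t (N 0 t) ^ t" using True N_nonneg by simp
      also have "\<dots> \<le> level q s ^ t"
        using T[of t] True s N_nonneg by (intro power_mono) auto
      also have "\<dots> \<le> C * level q s ^ t" using C lev by (simp add: mult_le_cancel_right1)
      finally show ?thesis .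
    next
      case False
      hence "N 0 t \<le> (\<Sum>t\<le>T. N 0 t)" using N_nonneg by (intro member_le_sum) auto
      also have "\<dots> \<le> C * 1" by (simp add: C_def)
      also have "\<dots> \<le> C * level q s ^ t" using C lev by (intro mult_left_mono one_le_power) auto
      finally show ?thesis .
    qed
    moreover obtain s' where s': "s < s'" "s' < \<alpha>" using s dense by blast
    ultimately obtain D where D: "\<And>k. N k 0 \<le> D * s' ^ k"
      using N_initial_upper[of s s' C] s by auto
    \<comment> \<open>\<open>N_initial_upper\<close> needs \<open>s'\<close> strictly above
      \<open>s\<close>; the further gap up to \<open>r\<close> absorbs the constant
      \<open>D\<close>.\<close>
    obtain r where r: "s' < r" "r < \<alpha>" using s' dense by blast
    have "0 < s'" using s s' sqrt_q by linarith
    hence "\<forall>\<^sub>F t in sequentially. even (t + i) \<longrightarrow> root t (N t 0) < r" for i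
      using D r by (intro eventually_root_less) auto
    hence "\<forall>\<^sub>F t in sequentially. root t (N t 0) < r" by (rule eventually_both_parities)
    hence "limsup (\<lambda>t. ereal (root t (N t 0))) \<le> ereal r"
      by (intro Limsup_bounded) (auto elim: eventually_mono)
    thus False using lim r by simp
  qed
qed

end

section \<open>Walks in regular graphs\<close>

lemma (in bidirected_digraph) hop_system_mixed_walks:
  assumes "regular_graph G d" "3 \<le> d"
  shows "hop_system (real d - 1) (\<lambda>k m. real (card (mixed_walks x S k m)))"
proof
  fix k m
  have "card (mixed_walks x S k (Suc m)) = card (mixed_walks x S (Suc k) m)
      + (case k of 0 \<Rightarrow> 0 | Suc j \<Rightarrow> (if j = 0 then d else d - 1) * card (mixed_walks x S j m))"
    using assms by (intro card_mixed_walks_Suc) auto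
  thus "real (card (mixed_walks x S k (Suc m)))
      = hop (real d - 1) (\<lambda>j. real (card (mixed_walks x S j m))) k"
    using assms by (cases k) (auto simp: hop_def)
qed (use assms in auto)

theorem corollary1p5:
  fixes G :: "('v, 'e) pre_digraph" and arev :: "'e \<Rightarrow> 'e"
    and d :: nat and x :: 'v and S :: "'v set"
    and a b :: "nat \<Rightarrow> nat"
  assumes "d \<ge> 3"
    and "bidirected_digraph G arev"
    and "Digraph_Component.connected G"
    and "regular_graph G d"
    and "x \<in> verts G"
    and "S \<noteq> {}" and "S \<subseteq> verts G"
  defines "a \<equiv> num_nb_walks G arev x S"
    and "b \<equiv> num_walks G x S"
  shows
    "(\<exists>\<alpha>::real. \<alpha> \<ge> 0
        \<and> limsup (\<lambda>t. ereal (root t (real (a t)))) = ereal \<alpha>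
        \<and> limsup (\<lambda>t. ereal (root t (real (b t)))) = ereal (g d \<alpha>))
   \<and> (\<forall>\<alpha>::real. (\<lambda>t. root t (real (a t))) \<longlonglongrightarrow> \<alpha>
        \<and> (\<exists>t. even t \<and> walks_into G x S t \<noteq> {})
        \<and> (\<exists>t. odd t \<and> walks_into G x S t \<noteq> {})
        \<longrightarrow> (\<lambda>t. root t (real (b t))) \<longlonglongrightarrow> g d \<alpha>)
   \<and> (\<forall>\<alpha>::real. (\<lambda>t. root (2 * t) (real (a (2 * t)))) \<longlonglongrightarrow> \<alpha>
        \<and> (\<exists>t. even t \<and> walks_into G x S t \<noteq> {})
        \<longrightarrow> (\<lambda>t. root (2 * t) (real (b (2 * t)))) \<longlonglongrightarrow> g d \<alpha>)
   \<and> (\<forall>\<alpha>::real. (\<lambda>t. root (2 * t + 1) (real (a (2 * t + 1)))) \<longlonglongrightarrow> \<alpha>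
        \<and> (\<exists>t. odd t \<and> walks_into G x S t \<noteq> {})
        \<longrightarrow> (\<lambda>t. root (2 * t + 1) (real (b (2 * t + 1)))) \<longlonglongrightarrow> g d \<alpha>)"
proof -
  interpret bidirected_digraph G arev by fact
  define N where "N k m = real (card (mixed_walks x S k m))" for k m
  interpret H: hop_system "real d - 1" N
    unfolding N_def using assms by (intro hop_system_mixed_walks)
  have a: "N t 0 = real (a t)" and b: "N 0 t = real (b t)" for t
    by (simp_all add: N_def a_def b_def card_mixed_walks_0_left card_mixed_walks_0_right)
  have sub: "walks_into G x S t \<subseteq> walks_into G x (verts G) t" for t
    using assms(7) by (auto simp: walks_into_def)
  have fin: "finite (walks_into G x (verts G) t)" "card (walks_into G x (verts G) t) \<le> d ^ t" for t
    using finite_card_walks_from[of d x t] assms by auto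
  have pos: "0 < N 0 t" if "walks_into G x S t \<noteq> {}" for t
    using that finite_subset[OF sub fin(1)] by (simp add: b b_def num_walks_def card_gt_0_iff)
  have level: "g d \<alpha> = level (real d - 1) (max \<alpha> (sqrt (real d - 1)))" for \<alpha>
    using assms by (intro g_eq_level) simp
  have a_le: "a t \<le> d ^ t" for t
  proof -
    have "a t \<le> card (walks_into G x (verts G) t)"
      unfolding a_def num_nb_walks_def by (rule card_mono[OF fin(1)]) (use sub in blast)
    also have "\<dots> \<le> d ^ t" by (rule fin)
    finally show ?thesis .
  qed
  have root_le: "root t (real (a t)) \<le> real d" for t
  proof (cases "t = 0")
    case False
    have "root t (real (a t)) \<le> root t (real d ^ t)"
      using False a_le[of t] by (intro real_root_le_mono) (auto simp flip: of_nat_power)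
    thus ?thesis using False by (simp add: real_root_power_cancel)
  qed simp
  \<comment> \<open>The limit superior lives in the extended reals; the bounds 0 and
    \<open>d\<close> make it a real number.\<close>
  have "0 \<le> limsup (\<lambda>t. ereal (root t (real (a t))))"
    by (intro le_Limsup) (auto simp: real_root_ge_zero intro!: always_eventually)
  moreover have "limsup (\<lambda>t. ereal (root t (real (a t)))) \<le> ereal (real d)"
    by (intro Limsup_bounded) (auto simp: root_le intro!: always_eventually)
  ultimately obtain \<alpha> where \<alpha>: "0 \<le> \<alpha>" "limsup (\<lambda>t. ereal (root t (real (a t)))) = ereal \<alpha>"
    by (cases "limsup (\<lambda>t. ereal (root t (real (a t))))") auto
  \<comment> \<open>For the limit superior one walk of either parity is enough.\<close>
  obtain l where "walks_into G x S l \<noteq> {}"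
    using connected_walk_exists assms by blast
  from H.root_limsup[OF _ pos[OF this]] \<alpha>
  have "limsup (\<lambda>t. ereal (root t (real (b t)))) = ereal (g d \<alpha>)"
    by (simp add: a b level)
  with \<alpha> have limsup: "\<exists>\<alpha>::real. \<alpha> \<ge> 0
      \<and> limsup (\<lambda>t. ereal (root t (real (a t)))) = ereal \<alpha>
      \<and> limsup (\<lambda>t. ereal (root t (real (b t)))) = ereal (g d \<alpha>)" by blast
  have lim: "(\<lambda>t. root t (real (b t))) \<longlonglongrightarrow> g d \<alpha>"
    if "(\<lambda>t. root t (real (a t))) \<longlonglongrightarrow> \<alpha>" "even l" "walks_into G x S l \<noteq> {}"
      "odd l'" "walks_into G x S l' \<noteq> {}" for \<alpha> l l'
    using H.root_tendsto[of \<alpha> l l'] pos[of l] pos[of l'] that by (simp add: a b level)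
  \<comment> \<open>The even and the odd case are the instances \<open>i = 0\<close> and
    \<open>i = 1\<close> of \<open>root_tendsto_parity\<close>.\<close>
  have lim_even: "(\<lambda>t. root (2 * t) (real (b (2 * t)))) \<longlonglongrightarrow> g d \<alpha>"
    if "(\<lambda>t. root (2 * t) (real (a (2 * t)))) \<longlonglongrightarrow> \<alpha>" "even l" "walks_into G x S l \<noteq> {}"
    for \<alpha> l
    using H.root_tendsto_parity[of 0 \<alpha> l] pos[of l] that by (simp add: a b level)
  have lim_odd: "(\<lambda>t. root (2 * t + 1) (real (b (2 * t + 1)))) \<longlonglongrightarrow> g d \<alpha>"
    if "(\<lambda>t. root (2 * t + 1) (real (a (2 * t + 1)))) \<longlonglongrightarrow> \<alpha>" "odd l" "walks_into G x S l \<noteq> {}"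
    for \<alpha> l
    using H.root_tendsto_parity[of 1 \<alpha> l] pos[of l] that by (simp add: a b level)
  show ?thesis
    by (intro conjI allI impI limsup; elim conjE exE) (rule lim lim_even lim_odd; assumption)+
qed

end
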